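(* Let $(\mathcal{N},[\cdot,\dots,\cdot],\alpha,B,\beta)$ be a Hom-quadratic multiplicative $n$-ary Hom-Nambu algebra. Define the $(2n-1)$-ary product $$[x_1,\dots,x_{2n-1}]^{(1)}=[[x_1,\dots,x_n],\alpha(x_{n+1}),\dots,\alpha(x_{2n-1})]\qquad\text{for } x_i\in\mathcal{N}.$$ Then $\mathcal{N}^1=(\mathcal{N},[\cdot,\dots,\cdot]^{(1)},\alpha^2,B,\beta')$, where $\beta'=\beta\circ\alpha$, is a Hom-quadratic multiplicative $(2n-1)$-ary Hom-Nambu algebra.
   Context: $\mathbb{K}$ is an algebraically closed field of characteristic zero and $n\ge 2$. A multiplicative $n$-ary Hom-Nambu algebra $(\mathcal{N},[\cdot,\dots,\cdot],\alpha)$ is a $\mathbb{K}$-vector space $\mathcal{N}$ with an $n$-linear map $[\cdot,\dots,\cdot]:\mathcal{N}^n\to\mathcal{N}$ (not assumed skew-symmetric) and a linear map $\alpha:\mathcal{N}\to\mathcal{N}$ such that $\alpha([x_1,\dots,x_n])=[\alpha(x_1),\dots,\alpha(x_n)]$ and $$[\alpha(x_1),\dots,\alpha(x_{n-1}),[y_1,\dots,y_n]]=\sum_{i=1}^n[\alpha(y_1),\dots,\alpha(y_{i-1}),[x_1,\dots,x_{n-1},y_i],\alpha(y_{i+1}),\dots,\alpha(y_n)].$$ It is Hom-quadratic with $(B,\beta)$, written $(\mathcal{N},[\cdot,\dots,\cdot],\alpha,B,\beta)$, if $B$ is a nondegenerate symmetric bilinear form on $\mathcal{N}$ and $\beta\in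 End(\mathcal{N})$ satisfies $B([x_1,\dots,x_{n-1},y],\beta(z))+B(\beta(y),[x_1,\dots,x_{n-1},z])=0$ for all elements. *)

theory Defs
  imports "HOL-Computational_Algebra.Polynomial"
begin

text \<open>
  The ground field is a type \<open>'k\<close> of the classes \<open>alg_closed_field\<close> and \<open>field_char_0\<close>, and the
  algebra is a whole type \<open>'v\<close> made into a vector space over \<open>'k\<close> by \<open>scale\<close>; no dimension is
  assumed finite. Since a single statement relates products of different arities, an
  \<open>n\<close>-ary product is a function on lists, and only its values on lists of length \<open>n\<close> matter.
  List indices start at 0.
\<close>

definition multilinear ::
  "('k::field \<Rightarrow> 'v::ab_group_add \<Rightarrow> 'v) \<Rightarrow> nat \<Rightarrow> ('v list \<Rightarrow> 'v) \<Rightarrow> bool" where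
  "multilinear scale n br \<longleftrightarrow>
     (\<forall>xs i. length xs = n \<longrightarrow> i < n \<longrightarrow> Vector_Spaces.linear scale scale (\<lambda>v. br (xs[i := v])))"

locale mult_hom_nambu = vector_space scale
  for scale :: "'k::{alg_closed_field, field_char_0} \<Rightarrow> 'v::ab_group_add \<Rightarrow> 'v" +
  fixes n :: nat
    and br :: "'v list \<Rightarrow> 'v"
    and \<alpha> :: "'v \<Rightarrow> 'v"
  assumes arity: "2 \<le> n"
    and multilinear_br: "multilinear scale n br"
    and linear_twist: "Vector_Spaces.linear scale scale \<alpha>"
    and multiplicative: "length xs = n \<Longrightarrow> \<alpha> (br xs) = br (map \<alpha> xs)"
    and hom_nambu: "length xs = n - 1 \<Longrightarrow> length ys = n \<Longrightarrow>
      br (map \<alpha> xs @ [br ys]) = (\<Sum>i<n. br ((map \<alpha> ys)[i := br (xs @ [ys ! i])]))"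

text \<open>
  By symmetry, the nondegeneracy condition need only be stated in the first argument. In
  infinite dimension it means that \<open>x \<mapsto> B x\<close> is injective into the dual space.
\<close>

locale hom_quadratic_mult_hom_nambu = mult_hom_nambu scale n br \<alpha>
  for scale :: "'k::{alg_closed_field, field_char_0} \<Rightarrow> 'v::ab_group_add \<Rightarrow> 'v"
    and n :: nat
    and br :: "'v list \<Rightarrow> 'v"
    and \<alpha> :: "'v \<Rightarrow> 'v" +
  fixes B :: "'v \<Rightarrow> 'v \<Rightarrow> 'k"
    and \<beta> :: "'v \<Rightarrow> 'v"
  assumes form_linear_right: "Vector_Spaces.linear scale (*) (\<lambda>y. B x y)"
    and form_linear_left: "Vector_Spaces.linear scale (*) (\<lambda>x. B x y)"
    and form_symmetric: "B x y = B y x"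
    and form_nondegenerate: "(\<forall>y. B x y = 0) \<Longrightarrow> x = 0"
    and linear_form_twist: "Vector_Spaces.linear scale scale \<beta>"
    and hom_invariant: "length xs = n - 1 \<Longrightarrow>
      B (br (xs @ [y])) (\<beta> z) + B (\<beta> y) (br (xs @ [z])) = 0"

definition derived_product ::
  "nat \<Rightarrow> ('v list \<Rightarrow> 'v) \<Rightarrow> ('v \<Rightarrow> 'v) \<Rightarrow> 'v list \<Rightarrow> 'v" where
  "derived_product n br \<alpha> xs = br (br (take n xs) # map \<alpha> (drop n xs))"

end

theory Submission
  imports Defs
begin

text \<open>
  Up to applications of \<open>\<alpha>\<close>, the operator \<open>y \<mapsto> [x\<^sub>1, \<dots>, x\<^bsub>2n-2\<^esub>, y]\<^sup>(\<^sup>1\<^sup>)\<close> of the derived product is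
  the operator of the original product attached to the \<open>n - 1\<close> elements
  \<open>[x\<^sub>1, \<dots>, x\<^sub>n], \<alpha> x\<^bsub>n+1\<^esub>, \<dots>, \<alpha> x\<^bsub>2n-2\<^esub>\<close>. Hence the Hom-Nambu identity for the derived product
  follows by applying the original identity first to the outer bracket and then to the
  inner one, and invariance of the form is inherited directly.
\<close>

lemma sum_lessThan_add:
  fixes f :: "nat \<Rightarrow> 'a::comm_monoid_add"
  shows "(\<Sum>i<m + k. f i) = (\<Sum>i<m. f i) + (\<Sum>i<k. f (m + i))"
  by (induction k) (simp_all add: add.assoc)

context mult_hom_nambu
begin

lemma br_slot_linear:
  assumes "length xs = n" "i < n"
  shows "Vector_Spaces.linear scale scale (\<lambda>v. br (xs[i := v]))"
  using multilinear_br assms unfolding multilinear_def by blast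

lemma br_Cons_linear:
  assumes "length ws = n - 1"
  shows "Vector_Spaces.linear scale scale (\<lambda>v. br (v # ws))"
  using br_slot_linear[of "0 # ws" 0] assms arity by simp

text \<open>Needed because expanding the inner bracket of a derived product leaves a sum in the head
  slot of the outer one.\<close>

lemma br_Cons_sum:
  assumes "length ws = n - 1"
  shows "br ((\<Sum>j\<in>J. f j) # ws) = (\<Sum>j\<in>J. br (f j # ws))"
proof -
  interpret L: Vector_Spaces.linear scale scale "\<lambda>v. br (v # ws)"
    by (rule br_Cons_linear[OF assms])
  show ?thesis by (rule L.sum)
qed

text \<open>As \<open>2 \<le> n\<close> gives \<open>n \<le> 2 * n - 2\<close>, the inner bracket
  uses entries of \<open>xs\<close> only; the last argument sits in the outer bracket and picks up
  one \<alpha>.\<close>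

lemma derived_product_snoc:
  assumes "length xs = 2 * n - 2"
  shows "derived_product n br \<alpha> (xs @ [y]) = br ((br (take n xs) # map \<alpha> (drop n xs)) @ [\<alpha> y])"
  using assms arity by (simp add: derived_product_def)

lemma multilinear_derived_product:
  "multilinear scale (2 * n - 1) (derived_product n br \<alpha>)"
  unfolding multilinear_def
proof (intro allI impI)
  fix xs :: "'v list" and i
  assume len: "length xs = 2 * n - 1" and i: "i < 2 * n - 1"
  show "Vector_Spaces.linear scale scale (\<lambda>v. derived_product n br \<alpha> (xs[i := v]))"
  proof (cases "i < n")
    case True
    have "Vector_Spaces.linear scale scale
        ((\<lambda>v. br (v # map \<alpha> (drop n xs))) \<circ> (\<lambda>v. br ((take n xs)[i := v])))"
      using len arity True
      by (intro Vector_Spaces.linear_compose[OF br_slot_linear br_Cons_linear]) auto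
    then show ?thesis
      using True by (simp add: derived_product_def take_update_swap o_def)
  next
    case False
    let ?ws = "br (take n xs) # map \<alpha> (drop n xs)"
    \<comment> \<open>The inner bracket occupies slot 0 of the outer one, so argument
      \<open>i \<ge> n\<close> lands in slot \<open>Suc (i - n)\<close>, after passing through
      \<alpha>.\<close>
    have "Vector_Spaces.linear scale scale ((\<lambda>v. br (?ws[Suc (i - n) := v])) \<circ> \<alpha>)"
      using len arity i False
      by (intro Vector_Spaces.linear_compose[OF linear_twist br_slot_linear]) auto
    then show ?thesis
      using False by (simp add: derived_product_def drop_update_swap map_update o_def)
  qed
qed

lemma multiplicative_derived_product:
  assumes "length xs = 2 * n - 1"
  shows "\<alpha> (derived_product n br \<alpha> xs) = derived_product n br \<alpha> (map \<alpha> xs)"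
  using assms arity by (simp add: derived_product_def multiplicative take_map drop_map)

lemma hom_nambu_derived_product:
  assumes xs: "length xs = 2 * n - 2" and ys: "length ys = 2 * n - 1"
  shows "derived_product n br \<alpha> (map (\<alpha> \<circ> \<alpha>) xs @ [derived_product n br \<alpha> ys]) =
    (\<Sum>i<2 * n - 1. derived_product n br \<alpha>
       ((map (\<alpha> \<circ> \<alpha>) ys)[i := derived_product n br \<alpha> (xs @ [ys ! i])]))"
    (is "?lhs = (\<Sum>i<2 * n - 1. ?term i)")
proof -
  define X where "X = br (take n xs) # map \<alpha> (drop n xs)"
  define D where "D y = br (X @ [\<alpha> y])" for y
  define T where "T = map \<alpha> (take n ys)"
  \<comment> \<open>By multiplicativity \<open>br Y\<close> is \<alpha> of the derived product of
    \<open>ys\<close>, the last entry of the outer bracket in \<open>?lhs\<close>; \<open>W\<close>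
    is the tail of \<open>map \<alpha> Y\<close>.\<close>
  define Y where "Y = br T # map (\<alpha> \<circ> \<alpha>) (drop n ys)"
  define W where "W = map (\<alpha> \<circ> \<alpha> \<circ> \<alpha>) (drop n ys)"
  have len: "length X = n - 1" "length T = n" "length Y = n" "length W = n - 1"
    using xs ys arity by (auto simp: X_def T_def Y_def W_def)
  have D: "derived_product n br \<alpha> (xs @ [y]) = D y" for y
    by (simp add: derived_product_snoc[OF xs] D_def X_def)
  have "?lhs = br (map \<alpha> (map \<alpha> X) @ [br Y])"
    using xs ys arity
    by (simp add: derived_product_snoc X_def Y_def T_def derived_product_def multiplicative
        take_map drop_map o_assoc)
  also have "\<dots> = (\<Sum>i<n. br ((map \<alpha> Y)[i := br (map \<alpha> X @ [Y ! i])]))"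
    using len by (intro hom_nambu) auto
  \<comment> \<open>Splits off the summand \<open>i = 0\<close>, where the operator hits the inner
    bracket \<open>br T\<close>; the others hit an entry of \<open>drop n ys\<close>.\<close>
  also have "\<dots> = (\<Sum>i<Suc (n - 1). br ((map \<alpha> Y)[i := br (map \<alpha> X @ [Y ! i])]))"
    using arity by simp
  also have "\<dots> = br (br (map \<alpha> X @ [br T]) # W) +
      (\<Sum>k<n - 1. br (br (map \<alpha> T) # W[k := br (map \<alpha> X @ [(\<alpha> \<circ> \<alpha>) (ys ! (n + k))])]))"
    using ys len(2) arity
    by (subst sum.lessThan_Suc_shift)
      (auto simp: Y_def W_def multiplicative o_assoc intro!: sum.cong)
  also have "br (br (map \<alpha> X @ [br T]) # W) = (\<Sum>j<n. ?term j)"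
  proof -
    \<comment> \<open>The second use of the identity, now with \<open>X\<close> itself: since
      \<open>T ! j\<close> is \<alpha> of \<open>ys ! j\<close>, the new inner entry is exactly
      \<open>D (ys ! j)\<close>.\<close>
    have "br (map \<alpha> X @ [br T]) = (\<Sum>j<n. br ((map \<alpha> T)[j := br (X @ [T ! j])]))"
      using len by (intro hom_nambu) auto
    then have "br (br (map \<alpha> X @ [br T]) # W)
        = (\<Sum>j<n. br (br ((map \<alpha> T)[j := br (X @ [T ! j])]) # W))"
      by (simp add: br_Cons_sum len)
    also have "\<dots> = (\<Sum>j<n. ?term j)"
      using ys arity
      by (intro sum.cong refl, unfold D)
        (simp add: derived_product_def D_def T_def W_def take_update_swap take_map drop_map o_assoc)
    finally show ?thesis .
  qed
  also have "(\<Sum>k<n - 1. br (br (map \<alpha> T) # W[k := br (map \<alpha> X @ [(\<alpha> \<circ> \<alpha>) (ys ! (n + k))])]))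
      = (\<Sum>k<n - 1. ?term (n + k))"
  proof (intro sum.cong refl, unfold D)
    fix k
    \<comment> \<open>Every entry carries a spare \<alpha>, which multiplicativity pulls out; it is
      the \<alpha> that the derived product applies to its arguments from index \<open>n\<close>
      on.\<close>
    have "br (map \<alpha> X @ [(\<alpha> \<circ> \<alpha>) (ys ! (n + k))]) = \<alpha> (D (ys ! (n + k)))"
      using len arity by (simp add: D_def multiplicative)
    then show "br (br (map \<alpha> T) # W[k := br (map \<alpha> X @ [(\<alpha> \<circ> \<alpha>) (ys ! (n + k))])])
        = derived_product n br \<alpha> ((map (\<alpha> \<circ> \<alpha>) ys)[n + k := D (ys ! (n + k))])"
      by (simp add: derived_product_def T_def W_def drop_update_swap map_update take_map drop_map
          o_assoc)
  qed
  also have "(\<Sum>j<n. ?term j) + (\<Sum>k<n - 1. ?term (n + k)) = (\<Sum>i<n + (n - 1). ?term i)"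
    by (simp only: sum_lessThan_add)
  also have "n + (n - 1) = 2 * n - 1"
    by simp
  finally show ?thesis .
qed

lemma mult_hom_nambu_derived_product:
  "mult_hom_nambu scale (2 * n - 1) (derived_product n br \<alpha>) (\<alpha> ^^ 2)"
proof (intro mult_hom_nambu.intro vector_space_axioms mult_hom_nambu_axioms.intro)
  have twist: "\<alpha> ^^ 2 = \<alpha> \<circ> \<alpha>"
    by (simp add: numeral_2_eq_2)
  show "2 \<le> 2 * n - 1"
    using arity by simp
  show "multilinear scale (2 * n - 1) (derived_product n br \<alpha>)"
    by (rule multilinear_derived_product)
  show "Vector_Spaces.linear scale scale (\<alpha> ^^ 2)"
    unfolding twist by (rule Vector_Spaces.linear_compose[OF linear_twist linear_twist])
  show "(\<alpha> ^^ 2) (derived_product n br \<alpha> xs) = derived_product n br \<alpha> (map (\<alpha> ^^ 2) xs)"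
    if "length xs = 2 * n - 1" for xs
    using that by (simp add: twist multiplicative_derived_product)
  show "derived_product n br \<alpha> (map (\<alpha> ^^ 2) xs @ [derived_product n br \<alpha> ys]) =
      (\<Sum>i<2 * n - 1. derived_product n br \<alpha>
         ((map (\<alpha> ^^ 2) ys)[i := derived_product n br \<alpha> (xs @ [ys ! i])]))"
    if "length xs = 2 * n - 1 - 1" "length ys = 2 * n - 1" for xs ys
    unfolding twist using that by (intro hom_nambu_derived_product) simp_all
qed

end

theorem theorem5p10:
  fixes scale :: "'k::{alg_closed_field, field_char_0} \<Rightarrow> 'v::ab_group_add \<Rightarrow> 'v"
    and n :: nat
    and br :: "'v list \<Rightarrow> 'v"
    and \<alpha> \<beta> :: "'v \<Rightarrow> 'v"
    and B :: "'v \<Rightarrow> 'v \<Rightarrow> 'k"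
  assumes "hom_quadratic_mult_hom_nambu scale n br \<alpha> B \<beta>"
  shows "hom_quadratic_mult_hom_nambu scale (2 * n - 1)
           (derived_product n br \<alpha>) (\<alpha> ^^ 2) B (\<beta> \<circ> \<alpha>)"
proof -
  interpret hom_quadratic_mult_hom_nambu scale n br \<alpha> B \<beta>
    by (rule assms)
  show ?thesis
  proof (intro hom_quadratic_mult_hom_nambu.intro mult_hom_nambu_derived_product
      hom_quadratic_mult_hom_nambu_axioms.intro)
    show "Vector_Spaces.linear scale scale (\<beta> \<circ> \<alpha>)"
      by (rule Vector_Spaces.linear_compose[OF linear_twist linear_form_twist])
    show "B (derived_product n br \<alpha> (xs @ [y])) ((\<beta> \<circ> \<alpha>) z) +
        B ((\<beta> \<circ> \<alpha>) y) (derived_product n br \<alpha> (xs @ [z])) = 0"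
      if "length xs = 2 * n - 1 - 1" for xs y z
    proof -
      have len: "length xs = 2 * n - 2"
        using that by simp
      \<comment> \<open>This is the original invariance at \<alpha> y and \<alpha> z, which explains
        the twist \<open>\<beta> \<circ> \<alpha>\<close>.\<close>
      show ?thesis
        unfolding derived_product_snoc[OF len] o_apply
        using len arity by (intro hom_invariant) simp
    qed
  qed (fact form_linear_right form_linear_left form_symmetric | blast intro: form_nondegenerate)+
qed

end
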